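(* Let $D_N(x)$ denote the Dirichlet kernel. The energy of the circulant graph $C^{1,2}_n$ on $n$ vertices is given by $$E(C^{1,2}_n)=4\left(D_{\lfloor n/6\rfloor}(2\pi/n)+D_{\lfloor n/6\rfloor}(4\pi/n)\right).$$ For every integer $\gamma\geqslant 3$, the energy of the circulant graph $C^{1,\gamma}_n$ on $n$ vertices is given by $$E(C^{1,\gamma}_n)=4\sum_{m\in\{1,\gamma\}}\left(\sum_{l=0}^{\lceil\gamma/2\rceil-1}D_{\lfloor(2l+1)n/(2(\gamma+1))\rfloor}\left(\frac{2\pi m}{n}\right)-\sum_{l=0}^{\lceil\gamma/2\rceil-2}D_{\lfloor(2l+1)n/(2(\gamma-1))\rfloor}\left(\frac{2\pi m}{n}\right)\right).$$ Here $\lfloor x\rfloor$ denotes the greatest integer smaller than or equal to $x$ and $\lceil x\rceil$ denotes the smallest integer greater than or equal to $x$.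
   Context: For integers $1\leqslant\gamma_1\leqslant\cdots\leqslant\gamma_d$, the circulant graph $C^{\gamma_1,\ldots,\gamma_d}_n$ generated by $\gamma_1,\ldots,\gamma_d$ on $n$ vertices labelled $0,1,\ldots,n-1$ is the $2d$-regular graph such that each $v\in\mathbb{Z}/n\mathbb{Z}$ is connected to $v+\gamma_i \bmod n$ and to $v-\gamma_i \bmod n$ for all $i=1,\ldots,d$. The adjacency matrix $A=(A_{ij})$ of a graph on $n$ vertices is the $n\times n$ matrix, indexed by the vertices, such that $A_{ij}$ is the number of edges connecting vertices $i$ and $j$. The energy of a graph $G$ on $n$ vertices is $E(G)=\sum_{k=1}^n|\lambda_k|$, where $\lambda_1,\ldots,\lambda_n$ are the eigenvalues of $A$; for $C^{1,\gamma}_n$ the eigenvalues are $2\cos(2\pi k/n)+2\cos(2\pi\gamma k/n)$, $k=0,\ldots,n-1$. The Dirichlet kernel is $D_N(x)=1+2\sum_{k=1}^N\cos(kx)=\sin((N+1/2)x)/\sin(x/2)$.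
   Formalization: The formal statement assumes that n does not divide γ (for γ=2: n≥3), so that the graph has no loops; when n divides γ the formula is false, e.g. for γ=n=3 the energy is 6 but the right-hand side is 12. *)

theory Defs
  imports
    Complex_Main
    "Graph_Theory.Digraph"
    "Jordan_Normal_Form.Char_Poly"
begin

text \<open>
  Undirected multigraphs are encoded as symmetric multi-digraphs: an edge joining \<open>v\<close> and \<open>w\<close> is a
  pair of opposite arcs. The generators are given as a list, and the arc \<open>(v, i, s)\<close> leads from \<open>v\<close>
  to \<open>v + \<gamma>\<^sub>i\<close> if \<open>s\<close> holds and to \<open>v - \<gamma>\<^sub>i\<close> otherwise (modulo \<open>n\<close>); the opposite of
  \<open>(v, i, True)\<close> is \<open>(v + \<gamma>\<^sub>i mod n, i, False)\<close>. Hence every vertex has degree \<open>2 d\<close> for a list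
  of length \<open>d\<close>, edges being counted with multiplicity (e.g. when \<open>n = 2 \<gamma>\<^sub>i\<close>) and a loop
  contributing 2.
\<close>

definition circulant_graph :: "nat \<Rightarrow> nat list \<Rightarrow> (nat, nat \<times> nat \<times> bool) pre_digraph" where
  "circulant_graph n gs =
    \<lparr> verts = {0..<n},
      arcs = {0..<n} \<times> {0..<length gs} \<times> UNIV,
      tail = (\<lambda>(v, i, s). v),
      head = (\<lambda>(v, i, s). nat ((int v + (if s then int (gs ! i) else - int (gs ! i))) mod int n)) \<rparr>"

text \<open>
  The vertices of \<open>G\<close> are assumed to be \<open>0, \<dots>, card (verts G) - 1\<close>. For \<open>i \<noteq> j\<close> the number of
  arcs from \<open>i\<close> to \<open>j\<close> is the number of edges connecting \<open>i\<close> and \<open>j\<close>.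
\<close>

definition adjacency_matrix :: "(nat, 'e) pre_digraph \<Rightarrow> complex mat" where
  "adjacency_matrix G =
    mat (card (verts G)) (card (verts G))
      (\<lambda>(i, j). of_nat (card {e \<in> arcs G. tail G e = i \<and> head G e = j}))"

text \<open>
  The eigenvalues are taken with multiplicity, as the roots of the characteristic polynomial over
  the complex numbers, so that there are \<open>card (verts G)\<close> of them.
\<close>

definition graph_energy :: "(nat, 'e) pre_digraph \<Rightarrow> real" where
  "graph_energy G = (\<Sum>\<mu>\<in>#proots (char_poly (adjacency_matrix G)). cmod \<mu>)"

definition dirichlet_kernel :: "nat \<Rightarrow> real \<Rightarrow> real" where
  "dirichlet_kernel N x = 1 + 2 * (\<Sum>k=1..N. cos (real k * x))"

end

theory Submission
  imports Defs "HOL-Library.Real_Mod"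
begin

text \<open>
  The adjacency matrix of a circulant graph is diagonalised by the matrix of the characters of the
  integers modulo \<open>n\<close>, so its eigenvalues are \<open>\<lambda>\<^sub>k = 2 cos (2 \<pi> k / n) + 2 cos (2 \<pi> \<gamma> k / n)\<close> for
  \<open>k < n\<close> (\<open>char_poly_circulant_graph\<close>), and the energy is the sum of their absolute values. It
  remains to know their signs. As \<open>\<lambda>\<^sub>k = \<lambda>\<^sub>n\<^sub>-\<^sub>k\<close>, the sign depends only on the distance \<open>d \<le> n / 2\<close> of
  \<open>k\<close> to the nearest multiple of \<open>n\<close>.

  In the factorisation \<open>\<lambda>\<^sub>k = 4 cos (\<pi> (\<gamma>+1) d / n) cos (\<pi> (\<gamma>-1) d / n)\<close> the first factor changes its
  sign at \<open>d = (2 l + 1) n / (2 (\<gamma>+1))\<close>, the second at \<open>d = (2 l + 1) n / (2 (\<gamma>-1))\<close>, and these two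
  families of zeros interlace on \<open>0 \<le> d \<le> n / 2\<close>. Hence the number of zeros of the first family that
  are at least \<open>d\<close>, minus the corresponding number for the second family, is a weight \<open>w k\<close> with
  values 1 (where \<open>\<lambda>\<^sub>k \<ge> 0\<close>) and 0 (where \<open>\<lambda>\<^sub>k \<le> 0\<close>), so that \<open>\<bar>\<lambda>\<^sub>k\<bar> = (2 w k - 1) \<lambda>\<^sub>k\<close>
  (\<open>abs_eigenvalue_zeros_below\<close>).

  The graph has no loops, because \<open>n\<close> divides neither 1 nor \<open>\<gamma>\<close>; the trace \<open>\<Sum> \<lambda>\<^sub>k\<close> therefore vanishes
  and the energy is \<open>2 \<Sum> w k \<lambda>\<^sub>k\<close>. On the other hand a Dirichlet kernel \<open>D\<^sub>N\<close> at \<open>2 \<pi> m / n\<close> with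
  \<open>2 N < n\<close> is the sum of \<open>cos (2 \<pi> m k / n)\<close> over the residues \<open>k\<close> of distance at most \<open>N\<close> to 0.
  Cutting off at the zeros of both families, with opposite signs, produces exactly the weights
  \<open>w k\<close> (\<open>sum_dirichlet_kernels\<close>).
\<close>

section \<open>Additive characters of the integers modulo n\<close>

definition circulant_char :: "nat \<Rightarrow> int \<Rightarrow> complex" where
  "circulant_char n a = cis (2 * pi * real_of_int a / real n)"

lemma circulant_char_0 [simp]: "circulant_char n 0 = 1"
  by (simp add: circulant_char_def)

lemma circulant_char_add:
  "circulant_char n (a + b) = circulant_char n a * circulant_char n b"
  by (simp add: circulant_char_def cis_mult add_divide_distrib ring_distribs)

lemma circulant_char_eq_1_iff:
  assumes "n > 0"
  shows "circulant_char n a = 1 \<longleftrightarrow> int n dvd a"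
proof -
  have "circulant_char n a = 1 \<longleftrightarrow> (\<exists>k. 2 * pi * real_of_int a / real n = of_int k * (2 * pi))"
    unfolding circulant_char_def by (rule cis_eq_1_iff)
  also have "\<dots> \<longleftrightarrow> (\<exists>k. real_of_int a = real_of_int (int n * k))"
    using assms by (intro ex_cong1) (auto simp: field_simps)
  also have "\<dots> \<longleftrightarrow> int n dvd a"
    by (simp only: of_int_eq_iff dvd_def)
  finally show ?thesis .
qed

lemma circulant_char_mult_mod:
  assumes "n > 0"
  shows "circulant_char n (k * (a mod int n)) = circulant_char n (k * a)"
proof -
  have "k * a = k * (a mod int n) + int n * (k * (a div int n))"
    by (metis (no_types, opaque_lifting) distrib_left mod_mult_div_eq mult.left_commute)
  moreover have "circulant_char n (int n * (k * (a div int n))) = 1"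
    using assms by (simp add: circulant_char_eq_1_iff)
  ultimately show ?thesis
    by (metis circulant_char_add mult.right_neutral)
qed

lemma circulant_char_power: "circulant_char n (int k * a) = circulant_char n a ^ k"
  by (induction k) (simp_all add: ring_distribs circulant_char_add)

text \<open>
  A nontrivial character value \<open>z\<close> satisfies \<open>z ^ n = 1\<close>, so the geometric sum vanishes. This one
  identity is used twice: to invert the Fourier matrix, and to see that the eigenvalues add up to 0.
\<close>
lemma sum_circulant_char:
  assumes "n > 0"
  shows "(\<Sum>k<n. circulant_char n (int k * a)) = (if int n dvd a then of_nat n else 0)"
proof (cases "int n dvd a")
  case True
  then show ?thesis
    using assms by (simp add: circulant_char_power circulant_char_eq_1_iff[THEN iffD2])
next
  case False
  have "circulant_char n a ^ n = 1"
    using assms by (simp add: circulant_char_eq_1_iff flip: circulant_char_power)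
  then show ?thesis
    using assms False by (simp add: circulant_char_power sum_gp_strict circulant_char_eq_1_iff)
qed

lemma Re_circulant_char: "Re (circulant_char n a) = cos (2 * pi * real_of_int a / real n)"
  by (simp add: circulant_char_def)

lemma circulant_char_add_uminus:
  "circulant_char n a + circulant_char n (- a) = of_real (2 * cos (2 * pi * real_of_int a / real n))"
  by (simp add: circulant_char_def complex_eq_iff)


section \<open>The spectrum of a circulant graph\<close>

definition circulant_eigenvalue :: "nat \<Rightarrow> nat list \<Rightarrow> nat \<Rightarrow> real" where
  "circulant_eigenvalue n gs k = (\<Sum>g\<leftarrow>gs. 2 * cos (2 * pi * real (g * k) / real n))"

text \<open>
  Multiplying the adjacency matrix with a vector sums the values of the vector at the heads of the
  arcs leaving a vertex; a character turns the step \<open>\<plusminus> g\<close> along an arc into a scalar factor.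
\<close>
lemma adjacency_circulant_char:
  assumes n: "n > 0" and i: "i < n"
  shows "(\<Sum>j<n. of_nat (card {e \<in> arcs (circulant_graph n gs).
              tail (circulant_graph n gs) e = i \<and> head (circulant_graph n gs) e = j})
            * circulant_char n (int k * int j))
        = of_real (circulant_eigenvalue n gs k) * circulant_char n (int k * int i)"
proof -
  let ?G = "circulant_graph n gs"
  define out where "out = {e \<in> arcs ?G. tail ?G e = i}"
  have out: "out = (\<lambda>(t, s). (i, t, s)) ` ({..<length gs} \<times> UNIV)"
    using i by (auto simp: out_def circulant_graph_def image_iff)
  have fin: "finite out"
    unfolding out by simp
  have head: "head ?G (i, t, s) = nat ((int i + (if s then int (gs ! t) else - int (gs ! t))) mod int n)"
    for t s
    by (simp add: circulant_graph_def)
  have heads: "head ?G ` out \<subseteq> {..<n}"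
    using n by (auto simp: out head nat_less_iff)
  have char: "circulant_char n (int k * int (head ?G (i, t, s))) =
      circulant_char n (int k * (if s then int (gs ! t) else - int (gs ! t)))
        * circulant_char n (int k * int i)" for t s
  proof -
    have "circulant_char n (int k * int (head ?G (i, t, s))) =
        circulant_char n (int k * ((int i + (if s then int (gs ! t) else - int (gs ! t))) mod int n))"
      using n by (simp add: head)
    also have "\<dots> = circulant_char n (int k * (int i + (if s then int (gs ! t) else - int (gs ! t))))"
      using n by (rule circulant_char_mult_mod)
    finally show ?thesis
      by (simp only: distrib_left circulant_char_add mult.commute)
  qed
  have "(\<Sum>j<n. of_nat (card {e \<in> arcs ?G. tail ?G e = i \<and> head ?G e = j})
            * circulant_char n (int k * int j))
      = (\<Sum>j<n. \<Sum>e\<in>{e \<in> out. head ?G e = j}. circulant_char n (int k * int (head ?G e)))"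
    by (intro sum.cong) (auto simp: out_def conj_assoc)
  also have "\<dots> = (\<Sum>e\<in>out. circulant_char n (int k * int (head ?G e)))"
    by (rule sum.group[OF fin finite_lessThan heads])
  also have "\<dots> = (\<Sum>(t, s)\<in>{..<length gs} \<times> UNIV. circulant_char n (int k * int (head ?G (i, t, s))))"
    unfolding out by (subst sum.reindex) (auto simp: inj_on_def case_prod_unfold)
  also have "\<dots> = (\<Sum>t<length gs. (circulant_char n (int k * int (gs ! t))
        + circulant_char n (- (int k * int (gs ! t)))) * circulant_char n (int k * int i))"
    by (simp only: sum.cartesian_product[symmetric] char)
       (simp add: UNIV_bool ring_distribs add.commute)
  also have "\<dots> = (\<Sum>t<length gs. of_real (2 * cos (2 * pi * real (gs ! t * k) / real n)))
        * circulant_char n (int k * int i)"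
    by (simp only: circulant_char_add_uminus sum_distrib_right) (simp add: mult.commute)
  also have "\<dots> = of_real (circulant_eigenvalue n gs k) * circulant_char n (int k * int i)"
    by (simp add: circulant_eigenvalue_def sum_list_sum_nth atLeast0LessThan)
  finally show ?thesis .
qed

text \<open>The characters are the columns of an invertible matrix \<open>F\<close>, which thus diagonalises the graph.\<close>
lemma char_poly_circulant_graph:
  assumes n: "n > 0"
  shows "char_poly (adjacency_matrix (circulant_graph n gs)) =
    (\<Prod>k<n. [:- complex_of_real (circulant_eigenvalue n gs k), 1:])"
proof -
  define A where "A = adjacency_matrix (circulant_graph n gs)"
  define F where "F = mat n n (\<lambda>(i, k). circulant_char n (int k * int i))"
  define F' where "F' = mat n n (\<lambda>(k, j). circulant_char n (- (int k * int j)) / of_nat n)"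
  define D where "D = mat_diag n (\<lambda>k. complex_of_real (circulant_eigenvalue n gs k))"
  have A: "A \<in> carrier_mat n n"
    by (simp add: A_def adjacency_matrix_def circulant_graph_def)
  have F: "F \<in> carrier_mat n n" and F': "F' \<in> carrier_mat n n" and D: "D \<in> carrier_mat n n"
    by (simp_all add: F_def F'_def D_def)
  have FF': "F * F' = 1\<^sub>m n"
  proof (rule eq_matI)
    fix i j assume "i < dim_row (1\<^sub>m n)" and "j < dim_col (1\<^sub>m n)"
    then have ij: "i < n" "j < n" by auto
    have "(F * F') $$ (i, j) =
        (\<Sum>k<n. circulant_char n (int k * int i) * (circulant_char n (- (int k * int j)) / of_nat n))"
      using ij by (simp add: F_def F'_def scalar_prod_def atLeast0LessThan)
    also have "\<dots> = (\<Sum>k<n. circulant_char n (int k * (int i - int j))) / of_nat n"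
      by (simp add: sum_divide_distrib right_diff_distrib flip: circulant_char_add)
    also have "\<dots> = (if int n dvd int i - int j then 1 else 0)"
      using n by (simp add: sum_circulant_char)
    also have "int n dvd int i - int j \<longleftrightarrow> i = j"
      using ij by (metis mod_eq_dvd_iff mod_less of_nat_eq_iff zmod_int)
    finally show "(F * F') $$ (i, j) = 1\<^sub>m n $$ (i, j)"
      using ij by simp
  qed (use F F' in auto)
  then have F'F: "F' * F = 1\<^sub>m n"
    by (rule mat_mult_left_right_inverse[OF F F'])
  have AF: "A * F = F * D"
  proof (rule eq_matI)
    fix i k assume "i < dim_row (F * D)" and "k < dim_col (F * D)"
    then have ik: "i < n" "k < n" using F D by auto
    have "(A * F) $$ (i, k) = (\<Sum>j<n. of_nat (card {e \<in> arcs (circulant_graph n gs).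
              tail (circulant_graph n gs) e = i \<and> head (circulant_graph n gs) e = j})
            * circulant_char n (int k * int j))"
    proof -
      have [simp]: "card (verts (circulant_graph n gs)) = n"
        by (simp add: circulant_graph_def)
      show ?thesis
        using ik by (simp add: A_def F_def adjacency_matrix_def scalar_prod_def atLeast0LessThan)
    qed
    also have "\<dots> = of_real (circulant_eigenvalue n gs k) * circulant_char n (int k * int i)"
      using n ik by (intro adjacency_circulant_char)
    also have "\<dots> = (F * D) $$ (i, k)"
      using ik by (simp add: D_def mat_diag_mult_right[OF F]) (simp add: F_def)
    finally show "(A * F) $$ (i, k) = (F * D) $$ (i, k)" .
  qed (use A F D in auto)
  have "A = A * (F * F')"
    using A by (simp add: FF')
  also have "\<dots> = F * D * F'"
    using A F F' by (simp add: AF flip: assoc_mult_mat)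
  finally have "similar_mat A D"
    using A F F' D FF' F'F by (intro similar_matI[of A D F F' n]) auto
  then have "char_poly A = char_poly D"
    by (rule char_poly_similar)
  also have "\<dots> = (\<Prod>a\<leftarrow>diag_mat D. [:- a, 1:])"
    by (rule char_poly_upper_triangular[OF D]) (auto simp: D_def mat_diag_def)
  also have "diag_mat D = map (\<lambda>k. complex_of_real (circulant_eigenvalue n gs k)) [0..<n]"
    by (simp add: diag_mat_def D_def mat_diag_def)
  finally show ?thesis
    using prod.distinct_set_conv_list[of "[0..<n]" "\<lambda>k. [:- complex_of_real (circulant_eigenvalue n gs k), 1:]"]
    by (simp add: A_def o_def atLeast0LessThan)
qed

lemma graph_energy_circulant_graph:
  assumes "n > 0"
  shows "graph_energy (circulant_graph n gs) = (\<Sum>k<n. \<bar>circulant_eigenvalue n gs k\<bar>)"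
proof -
  have "proots (\<Prod>k<n. [:- complex_of_real (circulant_eigenvalue n gs k), 1:]) =
      (\<Sum>k<n. {#complex_of_real (circulant_eigenvalue n gs k)#})"
    by (subst proots_prod) auto
  also have "\<dots> = image_mset (\<lambda>k. complex_of_real (circulant_eigenvalue n gs k)) (mset_set {..<n})"
    by (simp add: sum_unfold_sum_mset)
  finally show ?thesis
    using assms
    by (simp add: graph_energy_def char_poly_circulant_graph
        image_mset.compositionality o_def sum_unfold_sum_mset)
qed

text \<open>
  Summed over all eigenvalues, each generator \<open>m\<close> contributes the trace of a shift by \<open>m\<close> and of its
  inverse, which have no fixed point.
\<close>
lemma sum_cos_residues:
  assumes "\<not> n dvd m"
  shows "(\<Sum>k<n. cos (2 * pi * real (m * k) / real n)) = 0"
proof (cases "n = 0")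
  case False
  have "(\<Sum>k<n. cos (2 * pi * real (m * k) / real n)) = Re (\<Sum>k<n. circulant_char n (int k * int m))"
    by (simp add: Re_circulant_char mult.commute)
  also have "\<dots> = 0"
    using assms False by (subst sum_circulant_char) auto
  finally show ?thesis .
qed simp


section \<open>Dirichlet kernels as sums over residues\<close>

abbreviation centred_abs :: "nat \<Rightarrow> nat \<Rightarrow> nat" where
  "centred_abs n k \<equiv> min k (n - k)"

lemma cos_centred_abs:
  assumes "k < n"
  shows "cos (2 * pi * real (m * centred_abs n k) / real n) = cos (2 * pi * real (m * k) / real n)"
proof (cases "k \<le> n - k")
  case False
  have "2 * pi * real (m * (n - k)) / real n = 2 * pi * real m - 2 * pi * real (m * k) / real n"
    using assms by (simp add: field_simps of_nat_diff)
  moreover have "cos (2 * pi * real m - x) = cos x" for x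
    using cos_int_2pin[of "int m"] sin_int_2pin[of "int m"] by (simp add: cos_diff)
  ultimately show ?thesis
    using False by (simp add: min_def)
qed (simp add: min_def)

text \<open>
  The kernel is the sum of \<open>cos (k x)\<close> over \<open>- N \<le> k \<le> N\<close>; as \<open>2 N < n\<close>, these \<open>k\<close> represent
  distinct residues modulo \<open>n\<close>.
\<close>
lemma dirichlet_kernel_residues:
  assumes N: "2 * N < n"
  shows "dirichlet_kernel N (2 * pi * real m / real n) =
    (\<Sum>k<n. if centred_abs n k \<le> N then cos (2 * pi * real (m * k) / real n) else 0)"
proof -
  define c where "c = (\<lambda>k. cos (2 * pi * real (m * k) / real n))"
  have refl: "c (n - k) = c k" if "k \<in> {1..N}" for k
  proof -
    have k: "k < n" "n - k < n" "min (n - k) (n - (n - k)) = min k (n - k)"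
      using that N by auto
    show ?thesis
      using cos_centred_abs[OF k(1), of m] cos_centred_abs[OF k(2), of m] k(3) by (simp add: c_def)
  qed
  have set: "{k \<in> {..<n}. centred_abs n k \<le> N} = insert 0 ({1..N} \<union> (\<lambda>k. n - k) ` {1..N})"
  proof -
    have "k \<in> (\<lambda>k. n - k) ` {1..N}" if "k < n" "n - k \<le> N" for k
      using that by (intro image_eqI[of _ _ "n - k"]) auto
    then show ?thesis
      using N by (auto simp: min_le_iff_disj)
  qed
  have inj: "inj_on (\<lambda>k. n - k) {1..N}"
    using N by (auto simp: inj_on_def)
  have "(\<Sum>k<n. if centred_abs n k \<le> N then c k else 0) = sum c {k \<in> {..<n}. centred_abs n k \<le> N}"
    by (simp only: sum.inter_filter finite_lessThan)
  also have "\<dots> = c 0 + sum c ({1..N} \<union> (\<lambda>k. n - k) ` {1..N})"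
    unfolding set using N by (subst sum.insert) auto
  also have "sum c ({1..N} \<union> (\<lambda>k. n - k) ` {1..N}) = sum c {1..N} + sum c ((\<lambda>k. n - k) ` {1..N})"
    using N by (intro sum.union_disjoint) auto
  also have "sum c ((\<lambda>k. n - k) ` {1..N}) = sum c {1..N}"
    using inj refl by (simp add: sum.reindex)
  also have "c 0 + (sum c {1..N} + sum c {1..N}) = dirichlet_kernel N (2 * pi * real m / real n)"
    by (simp add: dirichlet_kernel_def c_def mult_ac)
  finally show ?thesis
    by (simp only: c_def)
qed


section \<open>The signs of the eigenvalues\<close>

lemma cos_sign_half_period:
  assumes "real p - 1 / 2 \<le> y" and "y \<le> real p + 1 / 2"
  shows "(-1) ^ p * cos (pi * y) \<ge> 0"
proof -
  have "(-1) ^ p * cos (pi * y) = cos (pi * (y - real p))"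
    by (simp add: right_diff_distrib cos_diff mult.commute)
  moreover have "\<bar>pi * (y - real p)\<bar> \<le> pi / 2"
  proof -
    have "\<bar>y - real p\<bar> \<le> 1 / 2"
      using assms by linarith
    then have "pi * \<bar>y - real p\<bar> \<le> pi * (1 / 2)"
      by (intro mult_left_mono) auto
    then show ?thesis
      by (simp add: abs_mult)
  qed
  ultimately show ?thesis
    by (simp only:) (intro cos_ge_zero; linarith)
qed

text \<open>
  \<open>zeros_below n t\<close> counts the zeros \<open>y = l + 1/2\<close> of \<open>cos (\<pi> y)\<close> with \<open>0 < y < t / (2 n)\<close>, i.e. it
  is \<open>t / (2 n)\<close> rounded to the nearest integer, ties going down.
\<close>
definition zeros_below :: "nat \<Rightarrow> nat \<Rightarrow> nat" where
  "zeros_below n t = (t + n - 1) div (2 * n)"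

lemma zeros_below_bounds:
  assumes "n > 0"
  shows "2 * n * zeros_below n t \<le> t + n - 1" and "t \<le> 2 * n * zeros_below n t + n"
proof -
  define r where "r = (t + n - 1) mod (2 * n)"
  have "t + n - 1 = 2 * n * zeros_below n t + r" "r < 2 * n"
    using assms by (simp_all add: r_def zeros_below_def)
  then show "2 * n * zeros_below n t \<le> t + n - 1" and "t \<le> 2 * n * zeros_below n t + n"
    using assms by linarith+
qed

lemma cos_sign_zeros_below:
  assumes "n > 0"
  shows "(-1) ^ zeros_below n t * cos (pi * (real t / real (2 * n))) \<ge> 0"
proof (rule cos_sign_half_period)
  have "real (2 * n * zeros_below n t) \<le> real (t + n)" "real t \<le> real (2 * n * zeros_below n t + n)"
    using zeros_below_bounds[OF assms, of t] by linarith+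
  then show "real (zeros_below n t) - 1 / 2 \<le> real t / real (2 * n)"
    and "real t / real (2 * n) \<le> real (zeros_below n t) + 1 / 2"
    using assms by (simp_all add: field_simps)
qed

lemma zeros_below_le_iff:
  assumes "n > 0"
  shows "zeros_below n t \<le> l \<longleftrightarrow> t \<le> (2 * l + 1) * n"
proof -
  have "zeros_below n t \<le> l \<longleftrightarrow> t + n - 1 < 2 * n * Suc l"
    using assms by (simp add: zeros_below_def div_less_iff_less_mult mult.commute flip: less_Suc_eq_le)
  also have "\<dots> \<longleftrightarrow> t \<le> (2 * l + 1) * n"
    using assms by (auto simp: algebra_simps)
  finally show ?thesis .
qed

lemma zeros_below_le:
  assumes n: "n > 0" and t: "t \<le> n * s"
  shows "zeros_below n t \<le> s div 2"
proof -
  have "s \<le> 2 * (s div 2) + 1"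
    by linarith
  then have "n * s \<le> n * (2 * (s div 2) + 1)"
    by (intro mult_left_mono) auto
  with t show ?thesis
    by (simp add: zeros_below_le_iff[OF n] mult.commute)
qed

lemma sum_if_zeros_below:
  assumes "n > 0" and "zeros_below n t \<le> M"
  shows "(\<Sum>l<M. if t \<le> (2 * l + 1) * n then x else 0) = (real M - real (zeros_below n t)) * x"
proof -
  have "(\<Sum>l<M. if t \<le> (2 * l + 1) * n then x else 0) = (\<Sum>l\<in>{l \<in> {..<M}. t \<le> (2 * l + 1) * n}. x)"
    by (simp only: sum.inter_filter finite_lessThan)
  also have "{l \<in> {..<M}. t \<le> (2 * l + 1) * n} = {zeros_below n t..<M}"
    by (simp only: set_eq_iff mem_Collect_eq atLeastLessThan_iff lessThan_iff
        zeros_below_le_iff[OF assms(1)] conj_commute simp_thms HOL.all_simps)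
  finally show ?thesis
    using assms by (simp add: of_nat_diff)
qed

text \<open>
  The eigenvalue factors as \<open>4 cos (\<pi> (\<gamma>+1) d / n) cos (\<pi> (\<gamma>-1) d / n)\<close>. Let \<open>p\<close> and \<open>q\<close> count the
  zeros of the factors before \<open>d\<close>. The arguments of the two cosines differ by \<open>2 d / n \<le> 1\<close> half
  periods, so the zeros interlace and \<open>p - q\<close> is 0 or 1: the sign \<open>(-1) ^ (p + q)\<close> is the affine
  function \<open>1 - 2 (p - q)\<close>.
\<close>
lemma abs_eigenvalue_zeros_below:
  assumes n: "n > 0" and \<gamma>: "\<gamma> > 0" and d: "2 * d \<le> n"
  defines "p \<equiv> zeros_below n (d * (2 * (\<gamma> + 1)))" and "q \<equiv> zeros_below n (d * (2 * (\<gamma> - 1)))"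
  defines "c \<equiv> 2 * cos (2 * pi * real d / real n) + 2 * cos (2 * pi * real (\<gamma> * d) / real n)"
  shows "\<bar>c\<bar> = c * (1 - 2 * (real p - real q))"
proof -
  define a where "a = cos (pi * (real (d * (2 * (\<gamma> + 1))) / real (2 * n)))"
  define b where "b = cos (pi * (real (d * (2 * (\<gamma> - 1))) / real (2 * n)))"
  have c: "c = 4 * (a * b)"
  proof -
    define X where "X = pi * (real \<gamma> * real d / real n)"
    define Y where "Y = pi * (real d / real n)"
    have "pi * (real (d * (2 * (\<gamma> + 1))) / real (2 * n)) = X + Y"
      and "pi * (real (d * (2 * (\<gamma> - 1))) / real (2 * n)) = X - Y"
      using n \<gamma> by (simp_all add: X_def Y_def of_nat_diff field_simps)
    then have "a = cos (X + Y)" "b = cos (X - Y)"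
      by (simp_all only: a_def b_def)
    moreover have "c = 2 * cos (2 * Y) + 2 * cos (2 * X)"
      by (simp add: c_def X_def Y_def mult_ac)
    ultimately show ?thesis
      by (simp add: cos_times_cos algebra_simps)
  qed
  have "0 \<le> ((-1) ^ p * a) * ((-1) ^ q * b)"
    unfolding p_def q_def a_def b_def using n by (intro mult_nonneg_nonneg cos_sign_zeros_below)
  then have sign: "0 \<le> (-1) ^ (p + q) * c"
    by (simp add: c power_add mult_ac)
  have "q \<le> p"
    unfolding p_def q_def zeros_below_def by (intro div_le_mono diff_le_mono add_right_mono mult_left_mono) auto
  moreover have "p \<le> q + 1"
  proof -
    have "d * (2 * (\<gamma> + 1)) = d * (2 * (\<gamma> - 1)) + 4 * d"
      using \<gamma> by (cases \<gamma>) (simp_all add: algebra_simps)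
    also have "\<dots> \<le> (2 * q * n + n) + 2 * n"
      using zeros_below_bounds(2)[OF n, of "d * (2 * (\<gamma> - 1))"] d unfolding q_def[symmetric]
      by (simp add: mult_ac)
    finally show ?thesis
      unfolding p_def by (subst zeros_below_le_iff[OF n]) (simp add: algebra_simps)
  qed
  ultimately consider "p = q" | "p = q + 1"
    by linarith
  then show ?thesis
  proof cases
    case 1
    then have "(-1) ^ (p + q) = (1 :: real)"
      by (simp flip: mult_2)
    with sign 1 show ?thesis
      by simp
  next
    case 2
    then have "(-1) ^ (p + q) = (-1 :: real)"
      by (simp flip: mult_2)
    with sign 2 show ?thesis
      by simp
  qed
qed


section \<open>The energy formula\<close>

lemma odd_multiple_div_less:
  fixes l n s :: nat
  assumes n: "n > 0" and l: "2 * l + 1 < s"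
  shows "2 * ((2 * l + 1) * n div (2 * s)) < n"
proof -
  have "2 * s * ((2 * l + 1) * n div (2 * s)) \<le> (2 * l + 1) * n"
    by (rule times_div_less_eq_dividend)
  also have "\<dots> < s * n"
    using assms by (intro mult_strict_right_mono) auto
  finally have "s * (2 * ((2 * l + 1) * n div (2 * s))) < s * n"
    by (simp only: mult_ac)
  then show ?thesis
    by simp
qed

text \<open>
  Summing kernels cut off at the zeros \<open>(2 l + 1) n / (2 s)\<close> weights the residue \<open>k\<close> with the number
  of zeros not before its centred absolute value.
\<close>
lemma sum_dirichlet_kernels:
  assumes n: "n > 0" and s: "s > 0"
  shows "(\<Sum>l<s div 2. dirichlet_kernel ((2 * l + 1) * n div (2 * s)) (2 * pi * real m / real n)) =
    (\<Sum>k<n. (real (s div 2) - real (zeros_below n (centred_abs n k * (2 * s))))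
              * cos (2 * pi * real (m * k) / real n))"
proof -
  have "(\<Sum>l<s div 2. dirichlet_kernel ((2 * l + 1) * n div (2 * s)) (2 * pi * real m / real n)) =
      (\<Sum>l<s div 2. \<Sum>k<n. if centred_abs n k * (2 * s) \<le> (2 * l + 1) * n
          then cos (2 * pi * real (m * k) / real n) else 0)"
  proof (intro sum.cong refl)
    fix l assume "l \<in> {..<s div 2}"
    then have "2 * l + 1 < s"
      by auto
    then have "2 * ((2 * l + 1) * n div (2 * s)) < n"
      using n by (intro odd_multiple_div_less)
    moreover have "j \<le> (2 * l + 1) * n div (2 * s) \<longleftrightarrow> j * (2 * s) \<le> (2 * l + 1) * n" for j
      using s by (intro less_eq_div_iff_mult_less_eq) simp
    ultimately show "dirichlet_kernel ((2 * l + 1) * n div (2 * s)) (2 * pi * real m / real n) =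
        (\<Sum>k<n. if centred_abs n k * (2 * s) \<le> (2 * l + 1) * n
          then cos (2 * pi * real (m * k) / real n) else 0)"
      by (simp only: dirichlet_kernel_residues)
  qed
  also have "\<dots> = (\<Sum>k<n. \<Sum>l<s div 2. if centred_abs n k * (2 * s) \<le> (2 * l + 1) * n
          then cos (2 * pi * real (m * k) / real n) else 0)"
    by (rule sum.swap)
  also have "\<dots> = (\<Sum>k<n. (real (s div 2) - real (zeros_below n (centred_abs n k * (2 * s))))
              * cos (2 * pi * real (m * k) / real n))"
  proof (intro sum.cong refl sum_if_zeros_below n)
    fix k
    have "2 * centred_abs n k * s \<le> n * s"
      by (intro mult_right_mono) auto
    then show "zeros_below n (centred_abs n k * (2 * s)) \<le> s div 2"
      using n by (intro zeros_below_le) (simp_all add: mult_ac)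
  qed
  finally show ?thesis .
qed

text \<open>
  Index ranges open at the top cover \<open>\<gamma> = 2\<close> as well, where the second sum is empty. The numbers of
  summands \<open>(\<gamma> + 1) div 2\<close> and \<open>(\<gamma> - 1) div 2\<close> differ by 1, which gives the weight the value 1 at
  \<open>k = 0\<close>.
\<close>
lemma graph_energy_circulant_one_and:
  assumes n: "n > 0" and \<gamma>: "\<gamma> \<ge> 2" and dvd: "\<not> n dvd \<gamma>"
  shows "graph_energy (circulant_graph n [1, \<gamma>]) =
    4 * (\<Sum>m\<in>{1, \<gamma>}.
      (\<Sum>l<(\<gamma> + 1) div 2. dirichlet_kernel ((2 * l + 1) * n div (2 * (\<gamma> + 1))) (2 * pi * real m / real n))
    - (\<Sum>l<(\<gamma> - 1) div 2. dirichlet_kernel ((2 * l + 1) * n div (2 * (\<gamma> - 1))) (2 * pi * real m / real n)))"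
    (is "_ = 4 * (\<Sum>m\<in>_. ?S m)")
proof -
  define C where "C m k = cos (2 * pi * real (m * k) / real n)" for m k
  define w where "w k = real ((\<gamma> + 1) div 2) - real (zeros_below n (centred_abs n k * (2 * (\<gamma> + 1))))
    - (real ((\<gamma> - 1) div 2) - real (zeros_below n (centred_abs n k * (2 * (\<gamma> - 1)))))" for k
  have S: "?S m = (\<Sum>k<n. w k * C m k)" for m
  proof -
    have "\<gamma> + 1 > 0" "\<gamma> - 1 > 0"
      using \<gamma> by auto
    then show ?thesis
      by (simp only: sum_dirichlet_kernels[OF n] w_def C_def left_diff_distrib sum_subtractf)
  qed
  have "(\<gamma> + 1) div 2 = (\<gamma> - 1) div 2 + 1"
    using \<gamma> by linarith
  then have M: "real ((\<gamma> + 1) div 2) = real ((\<gamma> - 1) div 2) + 1"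
    by simp
  have abs: "\<bar>2 * C 1 k + 2 * C \<gamma> k\<bar> = (2 * C 1 k + 2 * C \<gamma> k) * (2 * w k - 1)" if "k < n" for k
  proof -
    have C: "C m k = cos (2 * pi * real (m * centred_abs n k) / real n)" for m
      using that by (simp only: C_def cos_centred_abs)
    have "\<bar>2 * C 1 k + 2 * C \<gamma> k\<bar> = (2 * C 1 k + 2 * C \<gamma> k)
        * (1 - 2 * (real (zeros_below n (centred_abs n k * (2 * (\<gamma> + 1))))
                  - real (zeros_below n (centred_abs n k * (2 * (\<gamma> - 1))))))"
      unfolding C mult_1 using n \<gamma> by (intro abs_eigenvalue_zeros_below) auto
    moreover have "2 * (M + 1 - p - (M - q)) - 1 = 1 - 2 * (p - q)" for M p q :: real
      by simp
    then have "2 * w k - 1 = 1 - 2 * (real (zeros_below n (centred_abs n k * (2 * (\<gamma> + 1))))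
                  - real (zeros_below n (centred_abs n k * (2 * (\<gamma> - 1)))))"
      by (simp only: w_def M)
    ultimately show ?thesis
      by (simp only:)
  qed
  have "graph_energy (circulant_graph n [1, \<gamma>]) = (\<Sum>k<n. \<bar>2 * C 1 k + 2 * C \<gamma> k\<bar>)"
    using n by (simp add: graph_energy_circulant_graph circulant_eigenvalue_def C_def)
  also have "\<dots> = (\<Sum>k<n. 4 * (w k * C 1 k) + 4 * (w k * C \<gamma> k) - 2 * C 1 k - 2 * C \<gamma> k)"
  proof (intro sum.cong refl)
    fix k assume "k \<in> {..<n}"
    then have "\<bar>2 * C 1 k + 2 * C \<gamma> k\<bar> = (2 * C 1 k + 2 * C \<gamma> k) * (2 * w k - 1)"
      by (intro abs) simp
    then show "\<bar>2 * C 1 k + 2 * C \<gamma> k\<bar> = 4 * (w k * C 1 k) + 4 * (w k * C \<gamma> k) - 2 * C 1 k - 2 * C \<gamma> k"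
      by (simp only:) (simp add: algebra_simps)
  qed
  also have "\<dots> = 4 * (\<Sum>k<n. w k * C 1 k) + 4 * (\<Sum>k<n. w k * C \<gamma> k)
      - 2 * (\<Sum>k<n. C 1 k) - 2 * (\<Sum>k<n. C \<gamma> k)"
    by (simp only: sum.distrib sum_subtractf sum_distrib_left)
  \<comment> \<open>\<open>n\<close> does not divide 1 either, as it would then divide \<open>\<gamma>\<close>.\<close>
  also have "(\<Sum>k<n. C 1 k) = 0"
    unfolding C_def using dvd by (intro sum_cos_residues) auto
  also have "(\<Sum>k<n. C \<gamma> k) = 0"
    unfolding C_def using dvd by (rule sum_cos_residues)
  also have "4 * (\<Sum>k<n. w k * C 1 k) + 4 * (\<Sum>k<n. w k * C \<gamma> k) - 2 * 0 - 2 * 0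
      = 4 * (\<Sum>m\<in>{1, \<gamma>}. \<Sum>k<n. w k * C m k)"
    using \<gamma> by simp
  finally show ?thesis
    by (simp only: S)
qed

theorem mainTheorem1:
  shows "(\<forall>n::nat. n \<ge> 3 \<longrightarrow>
      graph_energy (circulant_graph n [1, 2]) =
        4 * (dirichlet_kernel (nat \<lfloor>real n / 6\<rfloor>) (2 * pi / real n)
           + dirichlet_kernel (nat \<lfloor>real n / 6\<rfloor>) (4 * pi / real n)))
    \<and> (\<forall>(\<gamma>::nat) (n::nat). \<gamma> \<ge> 3 \<longrightarrow> n \<ge> 1 \<longrightarrow> \<not> n dvd \<gamma> \<longrightarrow>
      graph_energy (circulant_graph n [1, \<gamma>]) =
        4 * (\<Sum>m\<in>{1, \<gamma>}.
              (\<Sum>l = 0..nat \<lceil>real \<gamma> / 2\<rceil> - 1.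
                 dirichlet_kernel (nat \<lfloor>real ((2 * l + 1) * n) / real (2 * (\<gamma> + 1))\<rfloor>)
                   (2 * pi * real m / real n))
            - (\<Sum>l = 0..nat \<lceil>real \<gamma> / 2\<rceil> - 2.
                 dirichlet_kernel (nat \<lfloor>real ((2 * l + 1) * n) / real (2 * (\<gamma> - 1))\<rfloor>)
                   (2 * pi * real m / real n))))"
proof (intro conjI allI impI)
  fix n :: nat assume "n \<ge> 3"
  then have "\<not> n dvd 2"
    by (auto dest: dvd_imp_le)
  then show "graph_energy (circulant_graph n [1, 2]) =
      4 * (dirichlet_kernel (nat \<lfloor>real n / 6\<rfloor>) (2 * pi / real n)
         + dirichlet_kernel (nat \<lfloor>real n / 6\<rfloor>) (4 * pi / real n))"
    using \<open>n \<ge> 3\<close> floor_divide_of_nat_eq[of n 6, where ?'a = real]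
      graph_energy_circulant_one_and[of n 2]
    by simp
next
  fix \<gamma> n :: nat assume \<gamma>: "\<gamma> \<ge> 3" and n: "n \<ge> 1" and dvd: "\<not> n dvd \<gamma>"
  have ceil: "nat \<lceil>real \<gamma> / 2\<rceil> = (\<gamma> + 1) div 2"
    by linarith
  have sets: "{0..nat \<lceil>real \<gamma> / 2\<rceil> - 1} = {..<(\<gamma> + 1) div 2}" "{0..nat \<lceil>real \<gamma> / 2\<rceil> - 2} = {..<(\<gamma> - 1) div 2}"
    using \<gamma> unfolding ceil by auto
  have floor: "nat \<lfloor>real a / real b\<rfloor> = a div b" for a b
    by (simp add: floor_divide_of_nat_eq)
  show "graph_energy (circulant_graph n [1, \<gamma>]) =
      4 * (\<Sum>m\<in>{1, \<gamma>}.
            (\<Sum>l = 0..nat \<lceil>real \<gamma> / 2\<rceil> - 1.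
               dirichlet_kernel (nat \<lfloor>real ((2 * l + 1) * n) / real (2 * (\<gamma> + 1))\<rfloor>)
                 (2 * pi * real m / real n))
          - (\<Sum>l = 0..nat \<lceil>real \<gamma> / 2\<rceil> - 2.
               dirichlet_kernel (nat \<lfloor>real ((2 * l + 1) * n) / real (2 * (\<gamma> - 1))\<rfloor>)
                 (2 * pi * real m / real n)))"
    unfolding sets floor using n \<gamma> dvd by (intro graph_energy_circulant_one_and) auto
qed

end
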